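(* Let $\alpha>0$ be fixed. For each $\beta>0$ let $g_\beta(v)=\frac\alpha2(v_1^2+v_2^2)+\beta|v_1v_2|_0$ for $v\in\mathbb{R}^2$, $U=L^2(D;\mathbb{R}^2)$, $\mathcal{G}_\beta(u)=\int_D g_\beta(u(x))\,dx$, and let $(u_\beta,p_\beta)\in U\times U$ satisfy $$p_\beta=-S^*(Su_\beta-z),\qquad u_\beta\in\partial\mathcal{G}_\beta^*(p_\beta).$$ Let $\mathcal{I}_\beta=\{x\in D:p_\beta(x)\in Q_0\cup Q_{10}\cup Q_{20}\}$ (the free arc), where the sets $Q_0,Q_{10},Q_{20}$ depend on $\alpha,\beta$. Then $|\mathcal{I}_\beta|\to0$ as $\beta\to\infty$.
   Context: $D\subset\mathbb{R}^d$ ($d\ge1$) is a measurable set of finite Lebesgue measure (so that $\mathcal{G}_\beta:U\to\mathbb{R}$ is real-valued). $Y$ is a real Hilbert space identified with its dual, $z\in Y$ is given, and $S:U\to Y$ is a bounded linear operator with adjoint $S^*:Y\to U$; it is assumed that there is a Banach space $V$ continuously embedded in $L^r(D;\mathbb{R}^2)$ for some $r>2$ such that $S^*$ maps $Y$ continuously into $V$. $D,Y,z,S,V$ do not depend on $\beta$. $|t|_0=1$ if $t\ne0$ and $|0|_0=0$. $\mathcal{G}_\beta^*(p)=\sup_{u\in U}\langle u,p\rangle_U-\mathcal{G}_\beta(u)$ is the Fenchel conjugate on $U$ (identified with its dual) and $\partial\mathcal{G}_\beta^*$ its convex subdifferential. $|A|$ denotes the Lebesgue measure of $A\subset D$. The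 sets are $Q_0=\{q\in\mathbb{R}^2:|q_1|,|q_2|>\sqrt{2\alpha\beta}\}$, $Q_{10}=\{q\in\mathbb{R}^2:|q_1|>|q_2|=\sqrt{2\alpha\beta}\}$, $Q_{20}=\{q\in\mathbb{R}^2:|q_2|>|q_1|=\sqrt{2\alpha\beta}\}$. *)

theory Defs
  imports "HOL-Analysis.Analysis"
begin

text \<open>
  The spaces \<open>L\<^sup>r(D; E)\<close> are represented by sets of functions; equality of two elements is
  equality almost everywhere on \<open>D\<close>. Values outside \<open>D\<close> are irrelevant.
\<close>

definition Lp :: "real \<Rightarrow> 'a::euclidean_space set \<Rightarrow> ('a \<Rightarrow> 'b::euclidean_space) set" where
  "Lp r D = {f. f \<in> borel_measurable (lebesgue_on D) \<and>
                integrable (lebesgue_on D) (\<lambda>x. norm (f x) powr r)}"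

definition Lp_norm :: "real \<Rightarrow> 'a::euclidean_space set \<Rightarrow> ('a \<Rightarrow> 'b::euclidean_space) \<Rightarrow> real" where
  "Lp_norm r D f = (LINT x|lebesgue_on D. norm (f x) powr r) powr (1 / r)"

definition ae_eq :: "'a::euclidean_space set \<Rightarrow> ('a \<Rightarrow> 'b) \<Rightarrow> ('a \<Rightarrow> 'b) \<Rightarrow> bool" where
  "ae_eq D f h \<longleftrightarrow> (AE x in lebesgue_on D. f x = h x)"

definition L2_inner ::
    "'a::euclidean_space set \<Rightarrow> ('a \<Rightarrow> 'b::euclidean_space) \<Rightarrow> ('a \<Rightarrow> 'b) \<Rightarrow> real" where
  "L2_inner D u p = (LINT x|lebesgue_on D. u x \<bullet> p x)"

text \<open>
  The first conjunct makes \<open>S\<close> a map on equivalence classes; nothing is required of \<open>S\<close> on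
  functions that are not in \<open>L\<^sup>2\<close>.
\<close>

definition bounded_linear_L2 ::
    "'a::euclidean_space set \<Rightarrow> (('a \<Rightarrow> 'b::euclidean_space) \<Rightarrow> 'y::real_normed_vector) \<Rightarrow> bool" where
  "bounded_linear_L2 D S \<longleftrightarrow>
     (\<forall>u\<in>Lp 2 D. \<forall>v\<in>Lp 2 D. ae_eq D u v \<longrightarrow> S u = S v) \<and>
     (\<forall>u\<in>Lp 2 D. \<forall>v\<in>Lp 2 D. S (\<lambda>x. u x + v x) = S u + S v) \<and>
     (\<forall>c. \<forall>u\<in>Lp 2 D. S (\<lambda>x. c *\<^sub>R u x) = c *\<^sub>R S u) \<and>
     (\<exists>C. \<forall>u\<in>Lp 2 D. norm (S u) \<le> C * Lp_norm 2 D u)"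

definition is_adjoint_L2 ::
    "'a::euclidean_space set \<Rightarrow> (('a \<Rightarrow> 'b::euclidean_space) \<Rightarrow> 'y::real_inner)
       \<Rightarrow> ('y \<Rightarrow> 'a \<Rightarrow> 'b) \<Rightarrow> bool" where
  "is_adjoint_L2 D S Sa \<longleftrightarrow>
     (\<forall>y. Sa y \<in> Lp 2 D \<and> (\<forall>u\<in>Lp 2 D. S u \<bullet> y = L2_inner D u (Sa y)))"

text \<open>\<open>emb\<close> is a continuous linear injection of the normed space \<open>'v\<close> into \<open>L\<^sup>r(D; 'b)\<close>.\<close>

definition continuous_embedding_Lp ::
    "real \<Rightarrow> 'a::euclidean_space set \<Rightarrow> ('v::real_normed_vector \<Rightarrow> 'a \<Rightarrow> 'b::euclidean_space)
       \<Rightarrow> bool" where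
  "continuous_embedding_Lp r D emb \<longleftrightarrow>
     (\<forall>v. emb v \<in> Lp r D) \<and>
     (\<forall>v w. ae_eq D (emb (v + w)) (\<lambda>x. emb v x + emb w x)) \<and>
     (\<forall>c v. ae_eq D (emb (c *\<^sub>R v)) (\<lambda>x. c *\<^sub>R emb v x)) \<and>
     (\<forall>v w. ae_eq D (emb v) (emb w) \<longrightarrow> v = w) \<and>
     (\<exists>C. \<forall>v. Lp_norm r D (emb v) \<le> C * norm v)"

definition fenchel_conjugate ::
    "'a::euclidean_space set \<Rightarrow> (('a \<Rightarrow> 'b::euclidean_space) \<Rightarrow> real) \<Rightarrow> ('a \<Rightarrow> 'b) \<Rightarrow> ereal" where
  "fenchel_conjugate D G p = (SUP u\<in>Lp 2 D. ereal (L2_inner D u p - G u))"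

definition subdifferential ::
    "'a::euclidean_space set \<Rightarrow> (('a \<Rightarrow> 'b::euclidean_space) \<Rightarrow> ereal)
       \<Rightarrow> ('a \<Rightarrow> 'b) \<Rightarrow> ('a \<Rightarrow> 'b) set" where
  "subdifferential D F p =
     {u \<in> Lp 2 D. \<bar>F p\<bar> \<noteq> \<infinity> \<and>
        (\<forall>q\<in>Lp 2 D. F p + ereal (L2_inner D u (\<lambda>x. q x - p x)) \<le> F q)}"

definition abs0 :: "real \<Rightarrow> real" where
  "abs0 t = (if t = 0 then 0 else 1)"

definition g_fun :: "real \<Rightarrow> real \<Rightarrow> real^2 \<Rightarrow> real" where
  "g_fun \<alpha> \<beta> v = \<alpha> / 2 * ((v $ 1)\<^sup>2 + (v $ 2)\<^sup>2) + \<beta> * abs0 (v $ 1 * v $ 2)"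

definition G_fun ::
    "'a::euclidean_space set \<Rightarrow> real \<Rightarrow> real \<Rightarrow> ('a \<Rightarrow> real^2) \<Rightarrow> real" where
  "G_fun D \<alpha> \<beta> u = (LINT x|lebesgue_on D. g_fun \<alpha> \<beta> (u x))"

definition Q0 :: "real \<Rightarrow> real \<Rightarrow> (real^2) set" where
  "Q0 \<alpha> \<beta> = {q. \<bar>q $ 1\<bar> > sqrt (2 * \<alpha> * \<beta>) \<and> \<bar>q $ 2\<bar> > sqrt (2 * \<alpha> * \<beta>)}"

definition Q10 :: "real \<Rightarrow> real \<Rightarrow> (real^2) set" where
  "Q10 \<alpha> \<beta> = {q. \<bar>q $ 1\<bar> > \<bar>q $ 2\<bar> \<and> \<bar>q $ 2\<bar> = sqrt (2 * \<alpha> * \<beta>)}"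

definition Q20 :: "real \<Rightarrow> real \<Rightarrow> (real^2) set" where
  "Q20 \<alpha> \<beta> = {q. \<bar>q $ 2\<bar> > \<bar>q $ 1\<bar> \<and> \<bar>q $ 1\<bar> = sqrt (2 * \<alpha> * \<beta>)}"

definition free_arc ::
    "'a::euclidean_space set \<Rightarrow> real \<Rightarrow> real \<Rightarrow> ('a \<Rightarrow> real^2) \<Rightarrow> 'a set" where
  "free_arc D \<alpha> \<beta> p = {x \<in> D. p x \<in> Q0 \<alpha> \<beta> \<union> Q10 \<alpha> \<beta> \<union> Q20 \<alpha> \<beta>}"

end

theory Submission
  imports Defs
begin

text \<open>
  The adjoint states are bounded in \<open>L\<^sup>2\<close> uniformly in \<open>\<beta>\<close>, whereas on the free arc
  \<open>\<bar>p\<^sub>\<beta>\<bar>\<^sup>2 \<ge> 2\<alpha>\<beta>\<close>, so that Chebyshev's inequality bounds the measure of the free arc by a constant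
  divided by \<open>\<beta>\<close>.

  The uniform bound is a consequence of monotonicity. As \<open>G\<^sub>\<beta>\<close> is nonnegative and vanishes at \<open>0\<close>, its
  conjugate has a minimum with value \<open>0\<close> at \<open>0\<close>. Comparing \<open>p\<^sub>\<beta>\<close> with this minimizer in the subgradient
  inequality gives \<open>\<langle>u\<^sub>\<beta>, p\<^sub>\<beta>\<rangle> \<ge> 0\<close> (\<open>inner_nonneg_of_subgradient_conjugate\<close>). By the adjoint equation
  this is \<open>\<langle>S u\<^sub>\<beta>, S u\<^sub>\<beta> - z\<rangle> \<le> 0\<close>: the state lies in the ball with diameter \<open>[0, z]\<close>, hence
  \<open>\<bar>S u\<^sub>\<beta> - z\<bar> \<le> \<bar>z\<bar>\<close>. Since the adjoint of a bounded operator is bounded (\<open>adjoint_L2_bounded\<close>),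
  so is \<open>p\<^sub>\<beta>\<close>.
\<close>

lemma L2_inner_self_nonneg: "0 \<le> L2_inner D f f"
  by (simp add: L2_inner_def)

lemma Lp_norm_2: "Lp_norm 2 D f = sqrt (L2_inner D f f)"
  by (simp add: Lp_norm_def L2_inner_def powr_half_sqrt dot_square_norm)

lemma integrable_inner_self: "f \<in> Lp 2 D \<Longrightarrow> integrable (lebesgue_on D) (\<lambda>x. f x \<bullet> f x)"
  by (simp add: Lp_def dot_square_norm)

lemma zero_in_Lp: "(\<lambda>x. 0) \<in> Lp r D"
  by (simp add: Lp_def)

lemma L2_inner_cong_ae:
  assumes "f \<in> borel_measurable (lebesgue_on D)" "f' \<in> borel_measurable (lebesgue_on D)"
    and "h \<in> borel_measurable (lebesgue_on D)" "h' \<in> borel_measurable (lebesgue_on D)"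
    and "ae_eq D f f'" "ae_eq D h h'"
  shows "L2_inner D f h = L2_inner D f' h'"
  unfolding L2_inner_def
proof (rule integral_cong_AE)
  show "AE x in lebesgue_on D. f x \<bullet> h x = f' x \<bullet> h' x"
    using assms(5,6) unfolding ae_eq_def by eventually_elim simp
qed (use assms in measurable)

text \<open>
  Since \<open>G\<close> attains its minimum \<open>0\<close> at \<open>0\<close>, so does its conjugate; by monotonicity of the
  subdifferential, a subgradient at \<open>p\<close> makes no obtuse angle with the vector from this minimizer to \<open>p\<close>.
\<close>

lemma inner_nonneg_of_subgradient_conjugate:
  assumes G_nonneg: "\<And>v. v \<in> Lp 2 D \<Longrightarrow> 0 \<le> G v" and G_zero: "G (\<lambda>x. 0) = 0"
    and u: "u \<in> subdifferential D (fenchel_conjugate D G) p"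
  shows "0 \<le> L2_inner D u p"
proof -
  let ?F = "fenchel_conjugate D G"
  have F_zero: "?F (\<lambda>x. 0) \<le> 0"
    unfolding fenchel_conjugate_def
    by (rule SUP_least) (simp add: L2_inner_def G_nonneg)
  have F_nonneg: "0 \<le> ?F p"
    unfolding fenchel_conjugate_def
    by (rule SUP_upper2[OF zero_in_Lp]) (simp add: L2_inner_def G_zero)
  have "?F p + ereal (L2_inner D u (\<lambda>x. 0 - p x)) \<le> ?F (\<lambda>x. 0)"
    using u by (simp add: subdifferential_def zero_in_Lp del: diff_0)
  moreover have "L2_inner D u (\<lambda>x. 0 - p x) = - L2_inner D u p"
    by (simp add: L2_inner_def)
  ultimately have "?F p + ereal (- L2_inner D u p) \<le> 0"
    using F_zero by simp
  with F_nonneg show ?thesis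
    by (cases "?F p") auto
qed

lemma G_fun_nonneg: "0 \<le> \<alpha> \<Longrightarrow> 0 \<le> \<beta> \<Longrightarrow> 0 \<le> G_fun D \<alpha> \<beta> v"
  by (auto simp: G_fun_def g_fun_def abs0_def intro!: integral_nonneg_AE)

lemma G_fun_zero: "G_fun D \<alpha> \<beta> (\<lambda>x. 0) = 0"
  by (simp add: G_fun_def g_fun_def abs0_def)

text \<open>
  The estimate comes from \<open>\<parallel>S\<^sup>* y\<parallel>\<^sup>2 = \<langle>S S\<^sup>* y, y\<rangle> \<le> C \<parallel>S\<^sup>* y\<parallel> \<parallel>y\<parallel>\<close>.
\<close>

lemma adjoint_L2_bounded:
  assumes "bounded_linear_L2 D S" "is_adjoint_L2 D S Sa"
  obtains C where "\<And>y. L2_inner D (Sa y) (Sa y) \<le> (C * norm y)\<^sup>2"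
proof -
  obtain C where C: "\<And>v. v \<in> Lp 2 D \<Longrightarrow> norm (S v) \<le> C * Lp_norm 2 D v"
    using assms(1) unfolding bounded_linear_L2_def by blast
  show thesis
  proof
    fix y
    define n where "n = Lp_norm 2 D (Sa y)"
    have n: "0 \<le> n" "n\<^sup>2 = L2_inner D (Sa y) (Sa y)"
      by (simp_all add: n_def Lp_norm_2 L2_inner_self_nonneg)
    have Sa: "Sa y \<in> Lp 2 D" "S (Sa y) \<bullet> y = L2_inner D (Sa y) (Sa y)"
      using assms(2) unfolding is_adjoint_L2_def by blast+
    have "n * n = S (Sa y) \<bullet> y"
      using n Sa by (simp add: power2_eq_square)
    also have "\<dots> \<le> norm (S (Sa y)) * norm y"
      by (rule norm_cauchy_schwarz)
    also have "\<dots> \<le> (C * n) * norm y"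
      using C[OF Sa(1)] by (simp add: n_def mult_right_mono)
    finally have "n * n \<le> n * (C * norm y)"
      by (simp add: mult_ac)
    hence "n = 0 \<or> n \<le> C * norm y"
      using n(1) by (auto simp: mult_le_cancel_left)
    hence "n\<^sup>2 \<le> (C * norm y)\<^sup>2"
      using n(1) by (auto intro: power_mono)
    thus "L2_inner D (Sa y) (Sa y) \<le> (C * norm y)\<^sup>2"
      by (simp add: n)
  qed
qed

lemma norm_diff_le_of_inner_diff_nonpos:
  fixes s z :: "'y::real_inner"
  assumes "s \<bullet> (s - z) \<le> 0"
  shows "norm (s - z) \<le> norm z"
proof (rule power2_le_imp_le)
  have "(norm (s - z))\<^sup>2 = (norm z)\<^sup>2 + 2 * (s \<bullet> (s - z)) - (norm s)\<^sup>2"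
    by (simp add: power2_norm_eq_inner inner_diff_left inner_diff_right inner_commute)
  thus "(norm (s - z))\<^sup>2 \<le> (norm z)\<^sup>2"
    using assms by (smt (verit) zero_le_power2)
qed simp

lemma free_arc_norm_ge:
  assumes "0 \<le> \<alpha> * \<beta>" "x \<in> free_arc D \<alpha> \<beta> p"
  shows "2 * \<alpha> * \<beta> \<le> p x \<bullet> p x"
proof -
  have "sqrt (2 * \<alpha> * \<beta>) \<le> \<bar>p x $ 1\<bar>"
    using assms by (auto simp: free_arc_def Q0_def Q10_def Q20_def)
  also have "\<dots> \<le> norm (p x)"
    by (rule component_le_norm_cart)
  finally show ?thesis
    using assms(1) by (simp add: real_sqrt_le_iff' real_le_lsqrt norm_eq_sqrt_inner)
qed

lemma free_arc_measure_bound: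
  assumes D: "D \<in> lmeasurable" and "\<alpha> > 0" "\<beta> > 0" and p: "p \<in> Lp 2 D"
  shows "measure lebesgue (free_arc D \<alpha> \<beta> p) \<le> L2_inner D p p / (2 * \<alpha> * \<beta>)"
proof -
  let ?A = "{x \<in> space (lebesgue_on D). 2 * \<alpha> * \<beta> \<le> p x \<bullet> p x}"
  note D_sets = fmeasurableD[OF D]
  have "p \<in> borel_measurable (lebesgue_on D)"
    using p by (simp add: Lp_def)
  hence "?A \<in> sets (lebesgue_on D)"
    by measurable
  hence A: "?A \<in> sets lebesgue"
    using D_sets by (simp add: sets_restrict_space_iff)
  have A_fin: "?A \<in> lmeasurable"
    by (rule fmeasurableI2[OF D _ A]) auto
  have "measure lebesgue (free_arc D \<alpha> \<beta> p) \<le> measure lebesgue ?A"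
    \<comment> \<open>A set outside the \<open>\<sigma>\<close>-algebra has measure \<open>0\<close> by convention, so the inclusion suffices.\<close>
  proof (cases "free_arc D \<alpha> \<beta> p \<in> sets lebesgue")
    case True
    moreover have "free_arc D \<alpha> \<beta> p \<subseteq> ?A"
      using free_arc_norm_ge[of \<alpha> \<beta> _ D p] assms(2,3) by (auto simp: free_arc_def)
    ultimately show ?thesis
      using A_fin by (intro measure_mono_fmeasurable)
  next
    case False
    thus ?thesis
      by (simp add: measure_notin_sets)
  qed
  also have "\<dots> = measure (lebesgue_on D) ?A"
    using D_sets by (intro measure_restrict_space[symmetric]) auto
  also have "\<dots> \<le> L2_inner D p p / (2 * \<alpha> * \<beta>)"
    unfolding L2_inner_def
    using integrable_inner_self[OF p] assms(2,3)
    by (intro integral_Markov_inequality_measure[where A = "space (lebesgue_on D)"]) auto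
  finally show ?thesis .
qed

theorem theorem4p3:
  fixes D :: "(real^'d) set"
    and \<alpha> r :: real
    and S :: "(real^'d \<Rightarrow> real^2) \<Rightarrow> 'y::{real_inner, complete_space}"
    and Sa :: "'y \<Rightarrow> real^'d \<Rightarrow> real^2"
    and z :: 'y
    and emb :: "'v::banach \<Rightarrow> real^'d \<Rightarrow> real^2"
    and T :: "'y \<Rightarrow> 'v"
    and u p :: "real \<Rightarrow> real^'d \<Rightarrow> real^2"
  assumes "D \<in> lmeasurable"
    and "\<alpha> > 0"
    and "bounded_linear_L2 D S"
    and "is_adjoint_L2 D S Sa"
    and "r > 2"
    and "continuous_embedding_Lp r D emb"
    and "continuous_on UNIV T"
    and "\<And>y. ae_eq D (emb (T y)) (Sa y)"
    and "\<And>\<beta>. \<beta> > 0 \<Longrightarrow> u \<beta> \<in> Lp 2 D"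
    and "\<And>\<beta>. \<beta> > 0 \<Longrightarrow> p \<beta> \<in> Lp 2 D"
    and "\<And>\<beta>. \<beta> > 0 \<Longrightarrow> ae_eq D (p \<beta>) (\<lambda>x. - Sa (S (u \<beta>) - z) x)"
    and "\<And>\<beta>. \<beta> > 0 \<Longrightarrow>
           u \<beta> \<in> subdifferential D (fenchel_conjugate D (G_fun D \<alpha> \<beta>)) (p \<beta>)"
  shows "((\<lambda>\<beta>. measure lebesgue (free_arc D \<alpha> \<beta> (p \<beta>))) \<longlongrightarrow> 0) at_top"
proof -
  obtain C where C: "\<And>y. L2_inner D (Sa y) (Sa y) \<le> (C * norm y)\<^sup>2"
    using adjoint_L2_bounded[OF assms(3,4)] by blast
  have arc_le: "measure lebesgue (free_arc D \<alpha> \<beta> (p \<beta>)) \<le> (C * norm z)\<^sup>2 / (2 * \<alpha> * \<beta>)"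
    if \<beta>: "\<beta> > 0" for \<beta>
  proof -
    let ?y = "S (u \<beta>) - z"
    have Sa: "Sa ?y \<in> Lp 2 D" "S (u \<beta>) \<bullet> ?y = L2_inner D (u \<beta>) (Sa ?y)"
      using assms(4) assms(9)[OF \<beta>] unfolding is_adjoint_L2_def by blast+
    have meas: "u \<beta> \<in> borel_measurable (lebesgue_on D)" "p \<beta> \<in> borel_measurable (lebesgue_on D)"
      "(\<lambda>x. - Sa ?y x) \<in> borel_measurable (lebesgue_on D)"
      using assms(9,10)[OF \<beta>] Sa(1) by (auto simp: Lp_def)
    have "0 \<le> L2_inner D (u \<beta>) (p \<beta>)"
      using inner_nonneg_of_subgradient_conjugate[OF _ G_fun_zero assms(12)[OF \<beta>]]
        G_fun_nonneg[of \<alpha> \<beta> D] assms(2) \<beta> by simp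
    also have "\<dots> = L2_inner D (u \<beta>) (\<lambda>x. - Sa ?y x)"
      by (rule L2_inner_cong_ae) (use meas assms(11)[OF \<beta>] in \<open>auto simp: ae_eq_def\<close>)
    also have "\<dots> = - (S (u \<beta>) \<bullet> ?y)"
      unfolding Sa(2) by (simp add: L2_inner_def)
    finally have y_le: "norm ?y \<le> norm z"
      by (intro norm_diff_le_of_inner_diff_nonpos) simp
    have "L2_inner D (p \<beta>) (p \<beta>) = L2_inner D (\<lambda>x. - Sa ?y x) (\<lambda>x. - Sa ?y x)"
      by (rule L2_inner_cong_ae) (use meas assms(11)[OF \<beta>] in auto)
    also have "\<dots> = L2_inner D (Sa ?y) (Sa ?y)"
      by (simp add: L2_inner_def)
    also have "\<dots> \<le> (C * norm ?y)\<^sup>2"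
      by (rule C)
    also have "\<dots> \<le> (C * norm z)\<^sup>2"
      using y_le by (simp add: power_mult_distrib mult_left_mono power_mono)
    finally have "L2_inner D (p \<beta>) (p \<beta>) / (2 * \<alpha> * \<beta>) \<le> (C * norm z)\<^sup>2 / (2 * \<alpha> * \<beta>)"
      using assms(2) \<beta> by (intro divide_right_mono) auto
    with free_arc_measure_bound[OF assms(1,2) \<beta> assms(10)[OF \<beta>]] show ?thesis
      by (rule order_trans)
  qed
  show ?thesis
  proof (rule tendsto_sandwich[where f = "\<lambda>_. 0"])
    show "\<forall>\<^sub>F \<beta> in at_top. measure lebesgue (free_arc D \<alpha> \<beta> (p \<beta>)) \<le> (C * norm z)\<^sup>2 / (2 * \<alpha> * \<beta>)"
      using eventually_gt_at_top[of 0] by eventually_elim (rule arc_le)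
    have "filterlim (\<lambda>\<beta>. 2 * \<alpha> * \<beta>) at_top at_top"
      using assms(2)
      by (intro filterlim_tendsto_pos_mult_at_top[OF tendsto_const _ filterlim_ident]) simp
    thus "((\<lambda>\<beta>. (C * norm z)\<^sup>2 / (2 * \<alpha> * \<beta>)) \<longlongrightarrow> 0) at_top"
      by (intro real_tendsto_divide_at_top[OF tendsto_const])
  qed (auto intro: tendsto_const)
qed

end
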